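(* For every integer $n\equiv 2\pmod 4$ with $n\geq 10$, there exists a circulant graph of order $n$ which is regular of degree $n-4$ and is doubly Eulerian (an edge-maximal doubly Eulerian circulant graph of order $n$).
   Context: All graphs are finite, simple and connected. A circulant graph of order $n$ is a Cayley graph on the cyclic group $\mathbb{Z}_n$. An Eulerian circuit is a closed trail traversing every edge exactly once. Let $G$ be Eulerian with $m$ edges and $u$ a vertex. Two Eulerian circuits $u,v_1,\ldots,v_{m-1},u$ and $u,w_1,\ldots,w_{m-1},u$ are avoiding if for every $1\le i\le m-1$, $v_i\neq w_i$ and $v_i$ is not adjacent to $w_i$. $G$ is doubly Eulerian if for every vertex $u$ there is a pair of avoiding Eulerian circuits starting and ending at $u$. For even $n$, a doubly Eulerian graph of order $n$ is edge-maximal if it is regular of degree $n-4$ (the maximum possible). *)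

theory Defs
  imports "HOL-Algebra.Elementary_Groups" "Graph_Theory.Graph_Theory"
begin

text \<open>A finite simple graph is a \<open>pair_graph\<close>: a symmetric loop-free digraph without parallel arcs,
  an undirected edge being a pair of opposite arcs. Eulerian circuits must use every undirected edge
  once, so they are expressed through \<open>undirected_edges\<close> rather than the arc-based trails of
  \<open>Graph_Theory.Euler\<close>.\<close>

definition undirected_edges :: "'a pair_pre_digraph \<Rightarrow> 'a set set" where
  "undirected_edges G = (\<lambda>(x, y). {x, y}) ` parcs G"

definition regular_of_degree :: "'a pair_pre_digraph \<Rightarrow> nat \<Rightarrow> bool" where
  "regular_of_degree G d \<longleftrightarrow> (\<forall>v \<in> pverts G. out_degree (with_proj G) v = d)"

definition cayley_graph :: "('a, 'b) monoid_scheme \<Rightarrow> 'a set \<Rightarrow> 'a pair_pre_digraph" where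
  "cayley_graph A S =
     \<lparr> pverts = carrier A, parcs = {(x, x \<otimes>\<^bsub>A\<^esub> s) | x s. x \<in> carrier A \<and> s \<in> S} \<rparr>"

definition circulant_graph :: "nat \<Rightarrow> int pair_pre_digraph \<Rightarrow> bool" where
  "circulant_graph n G \<longleftrightarrow>
     (\<exists>S. S \<subseteq> carrier (integer_mod_group n) - {\<one>\<^bsub>integer_mod_group n\<^esub>} \<and>
          (\<forall>s \<in> S. inv\<^bsub>integer_mod_group n\<^esub> s \<in> S) \<and>
          G = cayley_graph (integer_mod_group n) S)"

text \<open>In a simple graph a circuit is determined by its vertex sequence, here of length \<open>m + 1\<close>
  with \<open>u\<close> as first and last entry, where \<open>m\<close> is the number of edges.\<close>

definition eulerian_circuit :: "'a pair_pre_digraph \<Rightarrow> 'a \<Rightarrow> 'a list \<Rightarrow> bool" where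
  "eulerian_circuit G u p \<longleftrightarrow>
     vwalk p (with_proj G) \<and> hd p = u \<and> last p = u \<and>
     distinct (map (\<lambda>(x, y). {x, y}) (vwalk_arcs p)) \<and>
     set (map (\<lambda>(x, y). {x, y}) (vwalk_arcs p)) = undirected_edges G"

definition eulerian_graph :: "'a pair_pre_digraph \<Rightarrow> bool" where
  "eulerian_graph G \<longleftrightarrow>
     pair_graph G \<and> connected (with_proj G) \<and> (\<exists>u \<in> pverts G. \<exists>p. eulerian_circuit G u p)"

definition avoiding :: "'a pair_pre_digraph \<Rightarrow> 'a list \<Rightarrow> 'a list \<Rightarrow> bool" where
  "avoiding G p q \<longleftrightarrow>
     (\<forall>i. 1 \<le> i \<and> i < card (undirected_edges G) \<longrightarrow> p ! i \<noteq> q ! i \<and> (p ! i, q ! i) \<notin> parcs G)"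

definition doubly_eulerian :: "'a pair_pre_digraph \<Rightarrow> bool" where
  "doubly_eulerian G \<longleftrightarrow>
     eulerian_graph G \<and>
     (\<forall>u \<in> pverts G. \<exists>p q. eulerian_circuit G u p \<and> eulerian_circuit G u q \<and> avoiding G p q)"

end

(*
Let n = 2k with k odd, and let G join x and y unless their cyclic distance is k-1, k or k+1; then
q + k is distinct from and non-adjacent to p whenever p and q differ by at most 1 modulo n. So it
suffices to find two Eulerian circuits of G, one based at 0 and one at k, whose corresponding
interior entries differ by at most 1; adding k to the second circuit gives the avoiding pair.

For k >= 7, pull one visit z* out of every vertex z: z* becomes a new vertex of degree 2, taking over
two edges {z, d} of z. The neighbours d are chosen such that reattaching every z* to shift z instead
of z yields exactly the same edge set, where shift is a permutation which moves every vertex by at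
most 1, except that it sends 0 to k. The split graph is connected with even degrees, so it has
an Eulerian circuit based at 0*. Gluing z* to z, respectively to shift z, gives the two circuits.
For k = 5 there is an explicit pair of circuits. Other base vertices are handled by rotation.
*)

theory Submission
  imports Defs
begin

section \<open>Eulerian circuits\<close>

definition edge_list :: "'a list \<Rightarrow> 'a set list" where
  "edge_list p = map (\<lambda>(x, y). {x, y}) (vwalk_arcs p)"

lemma edge_list_simps [simp]:
  "edge_list [] = []"
  "edge_list [x] = []"
  "edge_list (x # y # xs) = {x, y} # edge_list (y # xs)"
  by (simp_all add: edge_list_def)

lemma edge_list_Cons: "p \<noteq> [] \<Longrightarrow> edge_list (x # p) = {x, hd p} # edge_list p"
  by (cases p) auto

definition trail_in :: "'a set set \<Rightarrow> 'a list \<Rightarrow> bool" where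
  "trail_in E p \<longleftrightarrow> p \<noteq> [] \<and> distinct (edge_list p) \<and> set (edge_list p) \<subseteq> E"

lemma edge_list_append: "edge_list (xs @ v # ys) = edge_list (xs @ [v]) @ edge_list (v # ys)"
  by (induction xs rule: vwalk_arcs.induct) auto

lemma edge_list_map: "edge_list (map f p) = map (image f) (edge_list p)"
  by (induction p rule: vwalk_arcs.induct) auto

lemma length_edge_list: "length (edge_list p) = length p - 1"
  by (induction p rule: vwalk_arcs.induct) auto

lemma nth_edge_list: "Suc i < length p \<Longrightarrow> edge_list p ! i = {p ! i, p ! Suc i}"
proof (induction p arbitrary: i rule: vwalk_arcs.induct)
  case (3 x y xs)
  then show ?case by (cases i) auto
qed auto

lemma in_set_vwalk_imp_edge:
  assumes "v \<in> set p" "length p \<ge> 2"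
  shows "\<exists>e \<in> set (edge_list p). v \<in> e"
  using assms
proof (induction p rule: vwalk_arcs.induct)
  case (3 x y xs)
  then show ?case by (cases xs) auto
qed auto

lemma edge_subset_vwalk: "e \<in> set (edge_list p) \<Longrightarrow> e \<subseteq> set p"
  by (induction p rule: vwalk_arcs.induct) auto

text \<open>Every interior visit to \<open>v\<close> contributes two edges, the first and the last
  entry one each; a new first edge \<open>{x, y}\<close> flips the parity at \<open>x\<close> and at
  the old head \<open>y\<close>.\<close>

lemma odd_count_edge_list:
  assumes "\<forall>e \<in> set (edge_list p). card e = 2" "p \<noteq> []"
  shows "odd (length (filter (\<lambda>e. v \<in> e) (edge_list p))) \<longleftrightarrow> (v = hd p) \<noteq> (v = last p)"
  using assms
proof (induction p rule: vwalk_arcs.induct)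
  case (3 x y xs)
  then have "x \<noteq> y" by (auto simp: card_2_iff)
  then show ?case using 3 by auto
qed auto

text \<open>Cut the closed list at an occurrence of \<open>v\<close> and exchange the two
  pieces.\<close>

lemma closed_trail_rotate:
  assumes "hd p = last p" "v \<in> set p"
  obtains q where "hd q = v" "last q = v" "q \<noteq> []" "mset (edge_list q) = mset (edge_list p)"
    "length q = length p" 
proof -
  obtain as bs where p: "p = as @ v # bs"
    using assms(2) by (meson split_list)
  show ?thesis
  proof (cases as)
    case Nil
    with p assms(1) that show ?thesis by force
  next
    case (Cons a as')
    have a: "last (v # bs) = a" using assms(1) p Cons by simp
    obtain cs where cs: "v # bs = cs @ [a]"
      using a by (metis append_butlast_last_id list.distinct(1))
    \<comment> \<open>The entry \<open>a\<close> ends \<open>v # bs\<close> and begins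
      \<open>as\<close>; writing \<open>v # bs\<close> as \<open>cs @ [a]\<close> keeps it from
      being doubled at the junction.\<close>
    let ?q = "cs @ a # as' @ [v]"
    have "edge_list ?q = edge_list (v # bs) @ edge_list (as @ [v])"
      unfolding cs Cons append_Cons by (rule edge_list_append)
    moreover have "edge_list p = edge_list (as @ [v]) @ edge_list (v # bs)"
      unfolding p by (rule edge_list_append)
    ultimately have "mset (edge_list ?q) = mset (edge_list p)" by simp
    moreover have "hd ?q = v"
      using cs by (cases cs) auto
    moreover have "length ?q = length p"
      using p Cons arg_cong[OF cs, of length] by simp
    ultimately show ?thesis by (intro that[of ?q]) auto
  qed
qed

lemma trail_in_mset_cong:
  assumes "trail_in E p" "mset (edge_list q) = mset (edge_list p)" "q \<noteq> []"
  shows "trail_in E q"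
  using assms mset_eq_imp_distinct_iff[OF assms(2)] mset_eq_setD[OF assms(2)]
  unfolding trail_in_def by auto

section \<open>Existence of an Eulerian circuit in a connected edge set with even degrees\<close>

lemma length_trail_in:
  assumes "trail_in E p" "finite E"
  shows "length p \<le> Suc (card E)"
proof -
  have "length (edge_list p) = card (set (edge_list p))"
    using assms(1) unfolding trail_in_def by (metis distinct_card)
  also have "\<dots> \<le> card E"
    using assms unfolding trail_in_def by (intro card_mono) auto
  finally show ?thesis by (simp add: length_edge_list)
qed

text \<open>A longest trail works: even degrees close it, its rotations show that it uses all edges
  at every vertex it visits, and connectivity spreads it over \<open>E\<close>. Edges are bare
  two-element sets so that the result applies to auxiliary graphs on any type.\<close>

theorem euler_circuit_exists:
  fixes E :: "'a set set"
  assumes fin: "finite E" and card2: "\<forall>e \<in> E. card e = 2"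
    and even: "\<And>v. even (card {e \<in> E. v \<in> e})"
    and conn: "\<forall>e \<in> E. \<forall>v \<in> e. (r, v) \<in> {(x, y). {x, y} \<in> E}\<^sup>*"
  obtains p where "p \<noteq> []" "hd p = r" "last p = r" "distinct (edge_list p)" "set (edge_list p) = E"
proof (cases "E = {}")
  case True
  then show ?thesis using that[of "[r]"] by simp
next
  case False
  then obtain a b where ab: "{a, b} \<in> E" "a \<noteq> b"
    using card2 by (metis all_not_in_conv card_2_iff)
  have t0: "trail_in E [a, b]"
    using ab by (simp add: trail_in_def)
  define p where "p = arg_max length (trail_in E)"
  have bound: "\<forall>q. trail_in E q \<longrightarrow> length q < Suc (Suc (card E))"
    using length_trail_in fin by (metis less_Suc_eq_le)
  have p: "trail_in E p" and max: "\<And>q. trail_in E q \<Longrightarrow> length q \<le> length p"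
    using arg_max_nat_lemma[OF t0 bound] unfolding p_def by auto
  have len: "length p \<ge> 2" using max[OF t0] by simp
  have maximal: "e \<in> set (edge_list q)"
    if q: "trail_in E q" "length q = length p" and e: "e \<in> E" "hd q \<in> e" for q e
  proof (rule ccontr)
    assume "e \<notin> set (edge_list q)"
    obtain y where "e = {y, hd q}"
      using e card2 by (metis card_2_iff insert_iff insert_commute singletonD)
    then have "trail_in E (y # q)"
      using q e \<open>e \<notin> set (edge_list q)\<close> by (auto simp: trail_in_def edge_list_Cons)
    then show False using max[of "y # q"] q(2) by simp
  qed
  \<comment> \<open>With distinct ends, the trail would use an odd number of edges at its head; by
    maximality these are all the edges there, an even number.\<close>
  have closed: "hd p = last p"
  proof (rule ccontr)
    assume "hd p \<noteq> last p"
    then have "odd (length (filter (\<lambda>e. hd p \<in> e) (edge_list p)))"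
      using odd_count_edge_list[of p "hd p"] p card2 unfolding trail_in_def by auto
    moreover have "length (filter (\<lambda>e. hd p \<in> e) (edge_list p)) = card {e \<in> set (edge_list p). hd p \<in> e}"
      using p distinct_card[of "filter (\<lambda>e. hd p \<in> e) (edge_list p)"] distinct_filter
      unfolding trail_in_def set_filter by metis
    moreover have "{e \<in> set (edge_list p). hd p \<in> e} = {e \<in> E. hd p \<in> e}"
      using maximal[OF p] p unfolding trail_in_def by blast
    ultimately show False using even by metis
  qed
  have saturated: "e \<in> set (edge_list p)" if "e \<in> E" "v \<in> e" "v \<in> set p" for e v
  proof -
    obtain q where q: "hd q = v" "q \<noteq> []" "mset (edge_list q) = mset (edge_list p)" "length q = length p"
      using closed_trail_rotate[OF closed \<open>v \<in> set p\<close>] by metis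
    then have "e \<in> set (edge_list q)"
      using maximal[of q e] trail_in_mset_cong[OF p] that by metis
    then show ?thesis using mset_eq_setD[OF q(3)] by simp
  qed
  let ?R = "{(x, y). {x, y} \<in> E}"
  have spread: "y \<in> set p" if "x \<in> set p" "(x, y) \<in> ?R\<^sup>*" for x y
    using that(2,1)
  proof (induction rule: rtrancl_induct)
    case (step y z)
    then have "{y, z} \<in> set (edge_list p)" using saturated by blast
    then show ?case using edge_subset_vwalk by fast
  qed
  have "sym (?R\<^sup>*)" by (intro sym_rtrancl symI) (auto simp: insert_commute)
  have inE: "set (edge_list p) \<subseteq> E" using p by (simp add: trail_in_def)
  have "p \<noteq> []" using len by auto
  have "hd p \<in> set p" using \<open>p \<noteq> []\<close> by simp
  then obtain e where "e \<in> E" "hd p \<in> e"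
    using in_set_vwalk_imp_edge[OF _ len] inE by blast
  \<comment> \<open>Connectivity is given from \<open>r\<close> outwards; by symmetry the trail,
    wherever it runs, can be followed back to \<open>r\<close>.\<close>
  then have "(hd p, r) \<in> ?R\<^sup>*"
    using conn \<open>sym (?R\<^sup>*)\<close> by (meson symD)
  then have r: "r \<in> set p" using spread \<open>hd p \<in> set p\<close> by blast
  have "E \<subseteq> set (edge_list p)"
  proof
    fix e assume "e \<in> E"
    then obtain v where "v \<in> e" using card2 by fastforce
    then show "e \<in> set (edge_list p)"
      using saturated spread[OF r] conn \<open>e \<in> E\<close> by blast
  qed
  with inE have "set (edge_list p) = E" by blast
  moreover obtain q where q: "hd q = r" "last q = r" "q \<noteq> []" "mset (edge_list q) = mset (edge_list p)"
    using closed_trail_rotate[OF closed r] by metis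
  moreover have "distinct (edge_list p)" using p by (simp add: trail_in_def)
  ultimately show ?thesis
    using that[OF q(3,1,2)] mset_eq_setD[OF q(4)] mset_eq_imp_distinct_iff[OF q(4)] by simp
qed

text \<open>An interior visit to \<open>r\<close> would use two edges at \<open>r\<close> besides
  the first one, three in all, but \<open>r\<close> has degree 2.\<close>

lemma euler_circuit_root_once:
  assumes "distinct (edge_list P)" "\<forall>e \<in> set (edge_list P). card e = 2"
    and "hd P = r" "card {e \<in> set (edge_list P). r \<in> e} = 2"
    and "1 \<le> i" "Suc i < length P"
  shows "P ! i \<noteq> r"
proof
  assume "P ! i = r"
  let ?e = "\<lambda>j. {P ! j, P ! Suc j}"
  have nth: "edge_list P ! j = ?e j" if "Suc j < length P" for j
    using nth_edge_list[OF that] .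
  have len: "length (edge_list P) = length P - 1"
    by (simp add: length_edge_list)
  have mem: "?e j \<in> set (edge_list P)" if "Suc j < length P" for j
  proof -
    have "j < length (edge_list P)" using that len by linarith
    then show ?thesis using nth_mem nth[OF that] by metis
  qed
  have inj: "?e j = ?e l \<longleftrightarrow> j = l" if "Suc j < length P" "Suc l < length P" for j l
    using nth[OF that(1)] nth[OF that(2)] that assms(1) len
      nth_eq_iff_index_eq[of "edge_list P" j l] by (metis Suc_eq_plus1 less_diff_conv)
  have P0: "P ! 0 = r" using assms by (cases P) auto
  have "P ! 0 \<noteq> P ! 1" using mem[of 0] assms by fastforce
  \<comment> \<open>For \<open>i = 1\<close> the edges number \<open>0\<close> and
    \<open>i - 1\<close> would coincide.\<close>
  then have "i \<ge> 2" using P0 \<open>P ! i = r\<close> \<open>1 \<le> i\<close> by (cases "i = 1") auto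
  have "?e 0 \<noteq> ?e (i - 1)" "?e 0 \<noteq> ?e i" "?e (i - 1) \<noteq> ?e i"
    using inj[of 0 "i-1"] inj[of 0 i] inj[of "i-1" i] assms(5,6) \<open>i \<ge> 2\<close> by auto
  then have "card {?e 0, ?e (i - 1), ?e i} = 3" by simp
  moreover have "{?e 0, ?e (i - 1), ?e i} \<subseteq> {e \<in> set (edge_list P). r \<in> e}"
    using mem[of 0] mem[of "i-1"] mem[of i] P0 \<open>P ! i = r\<close> assms(5,6) by auto
  ultimately have "3 \<le> card {e \<in> set (edge_list P). r \<in> e}"
    using card_mono[of "{e \<in> set (edge_list P). r \<in> e}" "{?e 0, ?e (i - 1), ?e i}"] by simp
  then show False using assms(4) by simp
qed

section \<open>Eulerian circuits of pair graphs, and circuits obtained by gluing vertices\<close>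

lemma eulerian_circuitI:
  assumes "pair_graph G" "u \<in> pverts G" "p \<noteq> []" "hd p = u" "last p = u"
    and "distinct (edge_list p)" "set (edge_list p) = undirected_edges G"
  shows "eulerian_circuit G u p"
proof -
  interpret pair_graph G by fact
  have arc: "(x, y) \<in> parcs G" if "{x, y} \<in> undirected_edges G" for x y
    using that pair_sym_arcs
    by (auto simp: undirected_edges_def doubleton_eq_iff symmetric_def dest: symD)
  have "set p \<subseteq> pverts G"
  proof (cases "length p \<ge> 2")
    case True
    show ?thesis
    proof
      fix v assume "v \<in> set p"
      then obtain e where "e \<in> undirected_edges G" "v \<in> e"
        using in_set_vwalk_imp_edge True assms(7) by metis
      then show "v \<in> pverts G"
        by (auto simp: undirected_edges_def dest: in_arcsD1 in_arcsD2)
    qed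
  next
    case False
    then have "p = [u]" using assms(3,4) by (cases p rule: vwalk_arcs.cases) auto
    then show ?thesis using assms(2) by simp
  qed
  moreover have "set (vwalk_arcs p) \<subseteq> parcs G"
    using arc assms(7) by (force simp: edge_list_def)
  ultimately show ?thesis
    using assms by (auto simp: eulerian_circuit_def vwalk_def edge_list_def)
qed

lemma eulerian_circuitD:
  assumes "eulerian_circuit G u p"
  shows "p \<noteq> []" "hd p = u" "last p = u" "distinct (edge_list p)"
    "set (edge_list p) = undirected_edges G"
  using assms by (auto simp: eulerian_circuit_def vwalk_def edge_list_def)

lemma length_eulerian_circuit:
  assumes "eulerian_circuit G u p"
  shows "length p = Suc (card (undirected_edges G))"
proof -
  have "length (edge_list p) = card (undirected_edges G)"
    using eulerian_circuitD[OF assms] distinct_card by metis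
  then show ?thesis
    using eulerian_circuitD(1)[OF assms] by (cases p) (auto simp: length_edge_list)
qed

lemma edge_list_map_bij:
  assumes "bij_betw (image f) W E" "distinct (edge_list p)" "set (edge_list p) = W"
  shows "distinct (edge_list (map f p))" "set (edge_list (map f p)) = E"
  using assms by (auto simp: edge_list_map distinct_map bij_betw_def)

lemma eulerian_circuit_map:
  assumes "pair_graph G" "\<phi> u \<in> pverts G" "bij_betw (image \<phi>) (undirected_edges G) (undirected_edges G)"
    and p: "eulerian_circuit G u p"
  shows "eulerian_circuit G (\<phi> u) (map \<phi> p)"
  using eulerian_circuitD[OF p] edge_list_map_bij[OF assms(3)] assms(1,2)
  by (intro eulerian_circuitI) (auto simp: hd_map last_map)

text \<open>An Eulerian circuit of an auxiliary graph \<open>W\<close> is read off twice, through \<open>f\<close> and through \<open>g\<close>.\<close>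

lemma avoiding_circuits_of_cover:
  fixes W :: "'w set set" and f g :: "'w \<Rightarrow> 'a"
  assumes "pair_graph G" "u \<in> pverts G"
    and W: "finite W" "\<forall>e \<in> W. card e = 2" "\<And>v. even (card {e \<in> W. v \<in> e})"
      "\<forall>e \<in> W. \<forall>v \<in> e. (r, v) \<in> {(x, y). {x, y} \<in> W}\<^sup>*"
    and r: "card {e \<in> W. r \<in> e} = 2" "f r = u" "g r = u"
    and f: "bij_betw (image f) W (undirected_edges G)"
    and g: "bij_betw (image g) W (undirected_edges G)"
    and avoid: "\<And>e w. e \<in> W \<Longrightarrow> w \<in> e \<Longrightarrow> w \<noteq> r \<Longrightarrow> f w \<noteq> g w \<and> (f w, g w) \<notin> parcs G"
  shows "\<exists>p q. eulerian_circuit G u p \<and> eulerian_circuit G u q \<and> avoiding G p q"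
proof -
  obtain P where P: "P \<noteq> []" "hd P = r" "last P = r" "distinct (edge_list P)" "set (edge_list P) = W"
    using euler_circuit_exists[OF W] by metis
  have fP: "eulerian_circuit G u (map f P)"
    using edge_list_map_bij[OF f P(4,5)] assms(1,2) P r
    by (intro eulerian_circuitI) (auto simp: hd_map last_map)
  have gP: "eulerian_circuit G u (map g P)"
    using edge_list_map_bij[OF g P(4,5)] assms(1,2) P r
    by (intro eulerian_circuitI) (auto simp: hd_map last_map)
  have len: "length P = Suc (card (undirected_edges G))"
    using length_eulerian_circuit[OF fP] by simp
  have "avoiding G (map f P) (map g P)"
    unfolding avoiding_def
  proof (intro allI impI)
    fix i assume i: "1 \<le> i \<and> i < card (undirected_edges G)"
    \<comment> \<open>Having degree 2, \<open>r\<close> occurs only at the two ends, so the one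
      vertex exempt from \<open>avoid\<close> never appears in the interior.\<close>
    then have "P ! i \<noteq> r"
      using euler_circuit_root_once[OF P(4) _ P(2), of i] P(5) W(2) r(1) len by simp
    moreover obtain e where "e \<in> W" "P ! i \<in> e"
      using in_set_vwalk_imp_edge[of "P ! i" P] i len P(5) by auto
    ultimately show "map f P ! i \<noteq> map g P ! i \<and> (map f P ! i, map g P ! i) \<notin> parcs G"
      using avoid i len by simp
  qed
  then show ?thesis using fP gP by blast
qed

section \<open>The circulant graph\<close>

text \<open>For representatives in \<open>{0..<2 * k}\<close> the cyclic distance is the smaller of
  \<open>\<bar>x - y\<bar>\<close> and \<open>2 * k - \<bar>x - y\<bar>\<close>; the last condition
  says that it is below \<open>k - 1\<close>.\<close>

definition opp_adj :: "int \<Rightarrow> int \<Rightarrow> int \<Rightarrow> bool" where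
  "opp_adj k x y \<longleftrightarrow> 0 \<le> x \<and> x < 2 * k \<and> 0 \<le> y \<and> y < 2 * k \<and> x \<noteq> y \<and> (\<bar>x - y\<bar> < k - 1 \<or> k + 1 < \<bar>x - y\<bar>)"

text \<open>This is the power of exponent \<open>k - 2\<close> of the cycle of length
  \<open>2 * k\<close>.\<close>

definition cycle_power :: "int \<Rightarrow> int pair_pre_digraph" where
  "cycle_power k = \<lparr> pverts = {0..<2 * k}, parcs = {(x, y). opp_adj k x y} \<rparr>"

lemma cycle_power_simps [simp]:
  "pverts (cycle_power k) = {0..<2 * k}"
  "parcs (cycle_power k) = {(x, y). opp_adj k x y}"
  by (simp_all add: cycle_power_def)

lemma opp_adj_sym: "opp_adj k x y \<Longrightarrow> opp_adj k y x"
  by (auto simp: opp_adj_def abs_minus_commute)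

lemma pair_graph_cycle_power: "pair_graph (cycle_power k)"
proof
  show "finite (parcs (cycle_power k))"
    by (rule finite_subset[of _ "{0..<2 * k} \<times> {0..<2 * k}"]) (auto simp: opp_adj_def)
qed (auto simp: opp_adj_def symmetric_def sym_def abs_minus_commute)

lemma edges_cycle_power: "undirected_edges (cycle_power k) = {{x, y} | x y. opp_adj k x y}"
  by (auto simp: undirected_edges_def)

lemma edge_cycle_power_iff: "{x, y} \<in> undirected_edges (cycle_power k) \<longleftrightarrow> opp_adj k x y"
  by (auto simp: edges_cycle_power doubleton_eq_iff dest: opp_adj_sym)

lemma circulant_cycle_power:
  assumes "k \<ge> 1"
  shows "circulant_graph (nat (2 * k)) (cycle_power k)"
proof -
  define S where "S = {s :: int. 0 < s \<and> s < 2 * k \<and> (s < k - 1 \<or> k + 1 < s)}"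
  have n: "int (nat (2 * k)) = 2 * k" "nat (2 * k) \<noteq> 0" using assms by auto
  have "opp_adj k x y \<longleftrightarrow> (\<exists>s\<in>S. 0 \<le> x \<and> x < 2 * k \<and> y = (x + s) mod (2 * k))" for x y
  proof
    assume *: "opp_adj k x y"
    let ?s = "if x < y then y - x else y - x + 2 * k"
    have "?s \<in> S" "0 \<le> x \<and> x < 2 * k" using * by (auto simp: S_def opp_adj_def abs_if split: if_splits)
    moreover have "y = (x + ?s) mod (2 * k)" using * by (auto simp: opp_adj_def)
    ultimately show "\<exists>s\<in>S. 0 \<le> x \<and> x < 2 * k \<and> y = (x + s) mod (2 * k)" by blast
  next
    assume "\<exists>s\<in>S. 0 \<le> x \<and> x < 2 * k \<and> y = (x + s) mod (2 * k)"
    then obtain s where s: "s \<in> S" "0 \<le> x" "x < 2 * k" "y = (x + s) mod (2 * k)" by blast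
    \<comment> \<open>Both summands are below \<open>2 * k\<close>, so one subtraction suffices to
      reduce their sum.\<close>
    have "y = (if x + s < 2 * k then x + s else x + s - 2 * k)"
      using s mod_pos_pos_trivial[of "x + s - 2 * k" "2 * k"] by (auto simp: S_def)
    then show "opp_adj k x y" using s by (auto simp: opp_adj_def S_def split: if_splits)
  qed
  then have "cycle_power k = cayley_graph (integer_mod_group (nat (2 * k))) S"
    using n by (auto simp: cycle_power_def cayley_graph_def carrier_integer_mod_group)
  moreover have "S \<subseteq> carrier (integer_mod_group (nat (2 * k))) - {\<one>\<^bsub>integer_mod_group (nat (2 * k))\<^esub>}"
    using n by (auto simp: S_def carrier_integer_mod_group)
  moreover have "\<forall>s\<in>S. inv\<^bsub>integer_mod_group (nat (2 * k))\<^esub> s \<in> S"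
  proof
    fix s assume s: "s \<in> S"
    then have "(- s) mod (2 * k) = 2 * k - s"
      by (simp add: S_def zmod_zminus1_eq_if)
    then show "inv\<^bsub>integer_mod_group (nat (2 * k))\<^esub> s \<in> S"
      using n s by (auto simp: S_def carrier_integer_mod_group)
  qed
  ultimately show ?thesis unfolding circulant_graph_def by blast
qed

lemma card_opp_adj:
  assumes "k \<ge> 5" "0 \<le> x" "x < 2 * k"
  shows "card {y. opp_adj k x y} = nat (2 * k) - 4"
proof -
  \<comment> \<open>\<open>c\<close> is the antipode of \<open>x\<close>; the non-neighbours of
    \<open>x\<close> are \<open>x\<close>, \<open>c\<close> and the two cyclic neighbours of
    \<open>c\<close>.\<close>
  define c where "c = (if x < k then x + k else x - k)"
  let ?N = "{x, c, if c = 2 * k - 1 then 0 else c + 1, if c = 0 then 2 * k - 1 else c - 1}"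
  have "{y. opp_adj k x y} = {0..<2 * k} - ?N"
    using assms by (auto simp: opp_adj_def c_def split: if_splits)
  moreover have "card ?N = 4" "?N \<subseteq> {0..<2 * k}"
    using assms by (auto simp: c_def)
  ultimately show ?thesis
    using card_Diff_subset[of ?N "{0..<2 * k}"] by simp
qed

lemma regular_cycle_power:
  assumes "k \<ge> 5"
  shows "regular_of_degree (cycle_power k) (nat (2 * k) - 4)"
  unfolding regular_of_degree_def
proof
  fix v assume v: "v \<in> pverts (cycle_power k)"
  have "out_arcs (with_proj (cycle_power k)) v = Pair v ` {y. opp_adj k v y}"
    by (auto simp: out_arcs_def)
  then have "out_degree (with_proj (cycle_power k)) v = card {y. opp_adj k v y}"
    by (simp add: out_degree_def card_image inj_on_def)
  then show "out_degree (with_proj (cycle_power k)) v = nat (2 * k) - 4"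
    using card_opp_adj[OF assms] v by simp
qed

lemma card_edges_at:
  "card {e \<in> undirected_edges (cycle_power k). x \<in> e} = card {y. opp_adj k x y}"
proof -
  have "{e \<in> undirected_edges (cycle_power k). x \<in> e} = (\<lambda>y. {x, y}) ` {y. opp_adj k x y}"
    by (auto simp: edges_cycle_power dest: opp_adj_sym)
  then show ?thesis
    by (simp add: card_image inj_on_def doubleton_eq_iff)
qed

text \<open>Any two vertices have a common neighbour: two disjoint neighbourhoods of size
  \<open>2 * k - 4\<close> do not fit into \<open>2 * k\<close> vertices when
  \<open>k \<ge> 5\<close>.\<close>

lemma connected_cycle_power:
  assumes "k \<ge> 5"
  shows "connected (with_proj (cycle_power k))"
proof -
  let ?H = "mk_symmetric (with_proj (cycle_power k))"
  interpret G: pair_graph "cycle_power k" by (rule pair_graph_cycle_power)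
  interpret pair_wf_digraph ?H by (rule G.wellformed_mk_symmetric)
  have step: "x \<rightarrow>\<^sup>*\<^bsub>with_proj ?H\<^esub> y" if "opp_adj k x y" for x y
    using that by (intro reachable_adjI) (force simp: parcs_mk_symmetric)
  have "x \<rightarrow>\<^sup>*\<^bsub>with_proj ?H\<^esub> y" if xy: "x \<in> {0..<2 * k}" "y \<in> {0..<2 * k}" for x y
  proof -
    have "{z. opp_adj k x z} \<inter> {z. opp_adj k y z} \<noteq> {}"
    proof
      assume disj: "{z. opp_adj k x z} \<inter> {z. opp_adj k y z} = {}"
      have sub: "{z. opp_adj k w z} \<subseteq> {0..<2 * k}" for w by (auto simp: opp_adj_def)
      then have "card ({z. opp_adj k x z} \<union> {z. opp_adj k y z}) \<le> card {0..<2 * k}"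
        by (intro card_mono) auto
      moreover have "finite {z. opp_adj k w z}" for w using sub finite_subset by blast
      ultimately have "2 * (nat (2 * k) - 4) \<le> nat (2 * k)"
        using card_Un_disjoint[OF _ _ disj] card_opp_adj[OF assms] xy by simp
      then show False using assms by linarith
    qed
    then obtain z where "opp_adj k x z" "opp_adj k z y" using opp_adj_sym by blast
    then show ?thesis using step reachable_trans by blast
  qed
  then show ?thesis
    using assms unfolding connected_def by (intro strongly_connectedI) auto
qed

section \<open>Rotations as automorphisms\<close>

definition rot :: "int \<Rightarrow> int \<Rightarrow> int \<Rightarrow> int" where
  "rot k u x = (if x + u < 2 * k then x + u else x + u - 2 * k)"

text \<open>A rotation changes \<open>x - y\<close> by 0 or by \<open>2 * k\<close> in absolute
  value, which leaves the cyclic distance as it is.\<close>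

lemma opp_adj_rot_iff:
  assumes "x \<in> {0..<2 * k}" "y \<in> {0..<2 * k}" "u \<in> {0..<2 * k}"
  shows "opp_adj k (rot k u x) (rot k u y) \<longleftrightarrow> opp_adj k x y"
  using assms unfolding opp_adj_def rot_def by (simp add: abs_if split: if_splits) linarith

lemma rot_edge:
  assumes "u \<in> {0..<2 * k}" "e \<in> undirected_edges (cycle_power k)"
  shows "rot k u ` e \<in> undirected_edges (cycle_power k)"
proof -
  obtain x y where xy: "e = {x, y}" "opp_adj k x y"
    using assms(2) unfolding edges_cycle_power by blast
  then have "x \<in> {0..<2 * k}" "y \<in> {0..<2 * k}" by (auto simp: opp_adj_def)
  then show ?thesis using xy opp_adj_rot_iff[OF _ _ assms(1)] by (simp add: edge_cycle_power_iff)
qed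

lemma bij_betw_rot:
  assumes "u \<in> {0..<2 * k}"
  shows "bij_betw (image (rot k u)) (undirected_edges (cycle_power k)) (undirected_edges (cycle_power k))"
proof (rule bij_betw_byWitness[where f' = "image (rot k (if u = 0 then 0 else 2 * k - u))"])
  \<comment> \<open>The inverse is the rotation by \<open>- u\<close>; \<open>u = 0\<close> is
    separate because \<open>2 * k\<close> is outside the range of representatives.\<close>
  let ?v = "if u = 0 then 0 else 2 * k - u"
  have v: "?v \<in> {0..<2 * k}" using assms by auto
  have inv: "rot k ?v (rot k u x) = x" "rot k u (rot k ?v x) = x" if "x \<in> {0..<2 * k}" for x
    using that assms by (auto simp: rot_def)
  have mem: "x \<in> {0..<2 * k}" "y \<in> {0..<2 * k}" if "opp_adj k x y" for x y
    using that by (auto simp: opp_adj_def)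
  show "\<forall>e\<in>undirected_edges (cycle_power k). rot k ?v ` rot k u ` e = e"
    "\<forall>e\<in>undirected_edges (cycle_power k). rot k u ` rot k ?v ` e = e"
    using inv mem by (auto simp: edges_cycle_power)
  show "image (rot k u) ` undirected_edges (cycle_power k) \<subseteq> undirected_edges (cycle_power k)"
    "image (rot k ?v) ` undirected_edges (cycle_power k) \<subseteq> undirected_edges (cycle_power k)"
    using rot_edge[OF assms] rot_edge[OF v] by blast+
qed

lemma doubly_eulerian_cycle_powerI:
  assumes "k \<ge> 5"
    and p: "eulerian_circuit (cycle_power k) 0 p" and q: "eulerian_circuit (cycle_power k) 0 q"
    and "avoiding (cycle_power k) p q"
  shows "doubly_eulerian (cycle_power k)"
proof -
  let ?G = "cycle_power k"
  have "\<exists>p q. eulerian_circuit ?G u p \<and> eulerian_circuit ?G u q \<and> avoiding ?G p q"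
    if u: "u \<in> pverts ?G" for u
  proof -
    have u': "u \<in> {0..<2 * k}" using u by simp
    have u0: "rot k u 0 = u" using u by (simp add: rot_def)
    have nth: "r ! i \<in> {0..<2 * k}" if "eulerian_circuit ?G 0 r" "i < card (undirected_edges ?G)" for r i
      using that length_eulerian_circuit[OF that(1)]
      unfolding eulerian_circuit_def vwalk_def by (auto dest!: subsetD simp: nth_mem)
    have "avoiding ?G (map (rot k u) p) (map (rot k u) q)"
      unfolding avoiding_def
    proof (intro allI impI)
      fix i assume i: "1 \<le> i \<and> i < card (undirected_edges ?G)"
      have "rot k u x \<noteq> rot k u y" if "x \<in> {0..<2 * k}" "y \<in> {0..<2 * k}" "x \<noteq> y" for x y
        using that u' by (auto simp: rot_def split: if_splits)
      then show "map (rot k u) p ! i \<noteq> map (rot k u) q ! i \<and> (map (rot k u) p ! i, map (rot k u) q ! i) \<notin> parcs ?G"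
        using i assms(4) nth[OF p] nth[OF q] opp_adj_rot_iff[OF _ _ u']
          length_eulerian_circuit[OF p] length_eulerian_circuit[OF q]
        by (simp add: avoiding_def)
    qed
    moreover have "eulerian_circuit ?G u (map (rot k u) r)" if "eulerian_circuit ?G 0 r" for r
      using eulerian_circuit_map[OF pair_graph_cycle_power _ bij_betw_rot[OF u'] that] u u0 by simp
    ultimately show ?thesis using p q by blast
  qed
  moreover have "eulerian_graph ?G"
    unfolding eulerian_graph_def
    using pair_graph_cycle_power connected_cycle_power[OF \<open>k \<ge> 5\<close>] p \<open>k \<ge> 5\<close> by force
  ultimately show ?thesis by (simp add: doubly_eulerian_def)
qed

section \<open>The graph of order 10\<close>

lemma avoiding_Cons_snoc:
  assumes "list_all2 (\<lambda>x y. x \<noteq> y \<and> (x, y) \<notin> parcs G) ps qs"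
    and "card (undirected_edges G) \<le> Suc (length ps)"
  shows "avoiding G (u # ps @ [u]) (u # qs @ [u])"
  unfolding avoiding_def
proof (intro allI impI)
  fix i assume i: "1 \<le> i \<and> i < card (undirected_edges G)"
  then have "i - 1 < length ps" "i - 1 < length qs"
    using assms list_all2_lengthD[OF assms(1)] by linarith+
  then show "(u # ps @ [u]) ! i \<noteq> (u # qs @ [u]) ! i \<and> ((u # ps @ [u]) ! i, (u # qs @ [u]) ! i) \<notin> parcs G"
    using i list_all2_nthD[OF assms(1)] by (simp add: nth_Cons' nth_append)
qed

text \<open>This case stands apart because the general construction uses the vertex
  \<open>k + 6\<close>, which must be below \<open>2 * k\<close>.\<close>

lemma doubly_eulerian_cycle_power_5: "doubly_eulerian (cycle_power 5)"
proof -
  let ?G = "cycle_power 5"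
  \<comment> \<open>These are the 29 interior entries of each circuit; the base vertex 0 is added at
    both ends below.\<close>
  let ?p = "[2, 4, 1, 0, 9, 1, 3, 5, 4, 6, 3, 4, 7, 6, 5, 2, 1, 8, 5, 7, 0, 8, 6, 9, 7, 8, 9, 2, 3] :: int list"
  let ?q = "[7, 8, 5, 6, 4, 5, 7, 9, 8, 1, 9, 0, 1, 2, 9, 6, 7, 4, 1, 3, 5, 2, 0, 3, 2, 4, 3, 6, 8] :: int list"
  \<comment> \<open>Every edge is a step by 1, 2 or 3 around the 10-cycle from one of its ends,
    which bounds the number of edges by 30.\<close>
  have sub: "undirected_edges ?G \<subseteq> (\<lambda>(x, s). {x, rot 5 s x}) ` ({0..<10} \<times> {1..3})"
  proof
    fix e assume "e \<in> undirected_edges ?G"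
    then obtain x y where e: "e = {x, y}" "opp_adj 5 x y" by (auto simp: edges_cycle_power)
    have "y - x \<in> {1..3} \<and> y = rot 5 (y - x) x \<or> y - x + 10 \<in> {1..3} \<and> y = rot 5 (y - x + 10) x \<or>
        x - y \<in> {1..3} \<and> x = rot 5 (x - y) y \<or> x - y + 10 \<in> {1..3} \<and> x = rot 5 (x - y + 10) y"
      using e(2) by (cases "x < y") (auto simp: opp_adj_def rot_def)
    then obtain s where "s \<in> {1..3}" "y = rot 5 s x \<or> x = rot 5 s y" by blast
    moreover have "x \<in> {0..<10}" "y \<in> {0..<10}" using e(2) by (auto simp: opp_adj_def)
    ultimately show "e \<in> (\<lambda>(x, s). {x, rot 5 s x}) ` ({0..<10} \<times> {1..3})"
      unfolding e(1) by (auto simp: insert_commute)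
  qed
  then have fin: "finite (undirected_edges ?G)" by (rule finite_subset) simp
  have le: "card (undirected_edges ?G) \<le> 30"
    using surj_card_le[OF _ sub] by simp
  \<comment> \<open>With at most 30 edges in the graph, 30 distinct ones exhaust it; what remains is
    a finite check of the lists.\<close>
  have circ: "set (edge_list p) = undirected_edges ?G"
    if p: "distinct (edge_list p)" "length (edge_list p) = 30"
      "set (edge_list p) \<subseteq> undirected_edges ?G" for p
    using p le fin by (intro card_seteq) (simp_all add: distinct_card)
  have p: "eulerian_circuit ?G 0 (0 # ?p @ [0])"
    by (intro eulerian_circuitI pair_graph_cycle_power circ)
      (simp_all add: doubleton_eq_iff edge_cycle_power_iff opp_adj_def)
  have q: "eulerian_circuit ?G 0 (0 # ?q @ [0])"
    by (intro eulerian_circuitI pair_graph_cycle_power circ)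
      (simp_all add: doubleton_eq_iff edge_cycle_power_iff opp_adj_def)
  have "avoiding ?G (0 # ?p @ [0]) (0 # ?q @ [0])"
    by (rule avoiding_Cons_snoc) (use le in \<open>simp_all add: opp_adj_def\<close>)
  then show ?thesis
    using p q by (intro doubly_eulerian_cycle_powerI) auto
qed

section \<open>Splitting one visit off every vertex\<close>

text \<open>The map \<open>h\<close> tells where each split-off copy \<open>Inr z\<close> is glued.
  Edges outside \<open>P\<close> are untouched, and the reattached ones run through \<open>P\<close>
  exactly once. One split graph thus serves both \<open>h = id\<close> and
  \<open>h = shift k\<close>.\<close>

lemma bij_betw_split:
  fixes h :: "'a \<Rightarrow> 'b"
  assumes "inj_on (\<lambda>(z, d). {h z, d}) S" "(\<lambda>(z, d). {h z, d}) ` S = P" "P \<subseteq> E"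
  shows "bij_betw (image (case_sum id h))
    (image Inl ` (E - P) \<union> (\<lambda>(z, d). {Inr z, Inl d}) ` S) E"
proof -
  let ?\<pi> = "image (case_sum id h)"
  have "bij_betw ?\<pi> (image Inl ` (E - P)) (E - P)"
    by (rule bij_betw_byWitness[where f' = "image Inl"]) (auto simp: image_image)
  moreover have "bij_betw ?\<pi> ((\<lambda>(z, d). {Inr z, Inl d}) ` S) P"
  proof (rule bij_betw_imageI)
    show "inj_on ?\<pi> ((\<lambda>(z, d). {Inr z, Inl d}) ` S)"
      by (rule inj_on_imageI) (use assms(1) in \<open>simp add: o_def case_prod_unfold\<close>)
    show "?\<pi> ` (\<lambda>(z, d). {Inr z, Inl d}) ` S = P"
      unfolding assms(2)[symmetric] image_image by (rule image_cong) auto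
  qed
  ultimately have "bij_betw ?\<pi> (image Inl ` (E - P) \<union> (\<lambda>(z, d). {Inr z, Inl d}) ` S) ((E - P) \<union> P)"
    by (rule bij_betw_combine) blast
  moreover have "(E - P) \<union> P = E" using assms(3) by blast
  ultimately show ?thesis by simp
qed

section \<open>The permutation \<open>shift\<close> and the choice of \<open>ports\<close>\<close>

text \<open>\<open>shift k\<close> is composed of the cycle \<open>0, k, k + 1, \<dots>, 2 k - 1\<close> and the transpositions
  \<open>(1 2) (3 4) \<dots> (k - 2 k - 1)\<close>; without \<open>0\<close> the remaining small vertices pair up because \<open>k\<close> is odd.
  The values of \<open>ports\<close> were found by computer search for \<open>k = 7\<close>; they extend to
  larger \<open>k\<close> because both \<open>k + 2\<close> and \<open>k + 3\<close> are adjacent to every additional vertex.\<close>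

definition shift :: "int \<Rightarrow> int \<Rightarrow> int" where
  "shift k z =
     (if z = 0 then k
      else if z < k then (if odd z then z + 1 else z - 1)
      else if z = 2 * k - 1 then 0
      else z + 1)"

definition ports :: "int \<Rightarrow> int \<Rightarrow> int set" where
  "ports k z =
     (if z = 0 then {k + 2, k + 5}
      else if z \<le> 4 then {0, k + 6}
      else if z = k then {k + 3, k + 5}
      else if z = k + 1 then {k + 3, k + 6}
      else if z = k + 2 then {k, k + 5}
      else if z = k + 3 \<or> z = k + 4 then {0, k + 2}
      else if z = k + 5 then {k + 1, k + 3}
      else {k + 2, k + 3})"

text \<open>The small vertices fall into \<open>{1..4}\<close> and \<open>{5..<k}\<close> because
  \<open>ports\<close> is constant on each block; \<open>shift\<close> preserves both blocks and is
  an involution there.\<close>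

lemma shift_cases:
  assumes "k \<ge> 7" "odd k" "z \<in> {0..<2 * k}"
  obtains "z = 0" "shift k z = k"
  | "1 \<le> z" "z \<le> 4" "1 \<le> shift k z" "shift k z \<le> 4" "shift k z = z + 1 \<or> shift k z = z - 1"
      "shift k (shift k z) = z"
  | "5 \<le> z" "z < k" "5 \<le> shift k z" "shift k z < k" "shift k z = z + 1 \<or> shift k z = z - 1"
      "shift k (shift k z) = z"
  | "k \<le> z" "z < 2 * k - 1" "shift k z = z + 1"
  | "z = 2 * k - 1" "shift k z = 0"
proof -
  consider "z = 0" | "1 \<le> z" "z \<le> 4" | "5 \<le> z" "z < k" | "k \<le> z" "z < 2 * k - 1" | "z = 2 * k - 1"
    using assms(3) by fastforce
  then show ?thesis
  proof cases
    case 2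
    then have "z = 1 \<or> z = 2 \<or> z = 3 \<or> z = 4" by linarith
    then show ?thesis using that(2) assms(1) by (auto simp: shift_def)
  next
    case 3
    show ?thesis
    proof (cases "odd z")
      case True
      \<comment> \<open>As \<open>k - 1\<close> is even, the partner \<open>z + 1\<close> of an odd
        \<open>z\<close> stays below \<open>k\<close>.\<close>
      then have "z \<noteq> k - 1" using assms(2) by auto
      then show ?thesis using that(3) 3 True by (auto simp: shift_def)
    next
      case False
      then have "z \<noteq> 5" by auto
      then show ?thesis using that(3) 3 False by (auto simp: shift_def)
    qed
  qed (use that assms(1) in \<open>auto simp: shift_def\<close>)
qed

lemma shift_inj:
  assumes "k \<ge> 7" "odd k"
  shows "inj_on (shift k) {0..<2 * k}"
proof (rule inj_onI)
  fix y z assume y: "y \<in> {0..<2 * k}" and z: "z \<in> {0..<2 * k}" and eq: "shift k y = shift k z"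
  show "y = z"
    \<comment> \<open>Different cases have disjoint ranges of \<open>shift\<close>; inside one block
      of small vertices the involution decides.\<close>
    by (cases rule: shift_cases[OF assms y]; cases rule: shift_cases[OF assms z];
        (use eq assms(1) in linarith | use eq in metis))
qed

lemma card_ports: "k \<ge> 7 \<Longrightarrow> card (ports k z) = 2"
  by (auto simp: ports_def)

lemma ports_subset: "d \<in> ports k z \<Longrightarrow> d \<in> {0, k, k + 1, k + 2, k + 3, k + 5, k + 6}"
  by (auto simp: ports_def split: if_splits)

lemma opp_adj_ports:
  assumes "k \<ge> 7" "z \<in> {0..<2 * k}" "d \<in> ports k z"
  shows "opp_adj k z d"
  using assms by (auto simp: ports_def opp_adj_def split: if_splits)

text \<open>No edge is handed over at both of its ends. This makes
  \<open>(z, d) \<mapsto> {z, d}\<close> injective on slots.\<close>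

lemma ports_asym:
  assumes "k \<ge> 7" "z \<in> {0..<2 * k}" "d \<in> ports k z"
  shows "z \<notin> ports k d"
  using assms ports_subset[OF assms(3)] by (auto simp: ports_def split: if_splits)

text \<open>This is the counterpart of \<open>ports_asym\<close> after regluing: slots of
  \<open>z\<close> and \<open>w\<close> cannot produce the same edge with opposite
  orientations.\<close>

lemma shift_ports_asym:
  assumes "k \<ge> 7" "odd k" "z \<in> {0..<2 * k}" "w \<in> {0..<2 * k}"
    and "shift k w \<in> ports k z"
  shows "shift k z \<notin> ports k w"
proof
  assume *: "shift k z \<in> ports k w"
  \<comment> \<open>Only seven vertices ever occur as ports, so \<open>x\<close> is one of their
    seven preimages under \<open>shift\<close>. Comparing the entries of this table for
    \<open>z\<close> and \<open>w\<close> excludes every pair.\<close>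
  have pre: "x = 2 * k - 1 \<and> shift k x = 0 \<and> ports k x = {k + 2, k + 3}
      \<or> x = 0 \<and> shift k x = k \<and> ports k x = {k + 2, k + 5}
      \<or> x = k \<and> shift k x = k + 1 \<and> ports k x = {k + 3, k + 5}
      \<or> x = k + 1 \<and> shift k x = k + 2 \<and> ports k x = {k + 3, k + 6}
      \<or> x = k + 2 \<and> shift k x = k + 3 \<and> ports k x = {k, k + 5}
      \<or> x = k + 4 \<and> shift k x = k + 5 \<and> ports k x = {0, k + 2}
      \<or> x = k + 5 \<and> shift k x = k + 6 \<and> ports k x = {k + 1, k + 3}"
    if "shift k x \<in> ports k y" "x \<in> {0..<2 * k}" for x y
  proof -
    have "x \<in> {2 * k - 1, 0, k, k + 1, k + 2, k + 4, k + 5}"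
      by (cases rule: shift_cases[OF assms(1,2) that(2)]) (use ports_subset[OF that(1)] assms(1) in auto)
    then show ?thesis
      using assms(1) by (elim insertE emptyE) (simp_all add: ports_def shift_def)
  qed
  show False
    using pre[OF assms(5,4)] pre[OF * assms(3)] assms(1,5) *
    by (elim disjE conjE) simp_all
qed

text \<open>Reattaching \<open>{z, d}\<close> at \<open>shift k z\<close> gives a slot edge again:
  either \<open>shift k z\<close> shares the port \<open>d\<close>, or the new edge is a slot of
  \<open>d\<close> in the reverse direction.\<close>

lemma shift_ports:
  assumes "k \<ge> 7" "odd k" "z \<in> {0..<2 * k}" "d \<in> ports k z"
  shows "d \<in> ports k (shift k z) \<or> shift k z \<in> ports k d"
  using assms(1-3)
proof (cases rule: shift_cases)
  case 1
  then show ?thesis using assms by (auto simp: ports_def)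
next
  case 2
  then show ?thesis using assms by (auto simp: ports_def)
next
  case 3
  then show ?thesis using assms by (auto simp: ports_def)
next
  case 4
  \<comment> \<open>From \<open>k + 6\<close> to \<open>2 * k - 1\<close> the ports are constant, so
    only six values need a separate look.\<close>
  consider "z = k" | "z = k + 1" | "z = k + 2" | "z = k + 3" | "z = k + 4" | "z = k + 5" | "k + 6 \<le> z"
    using 4 by linarith
  then show ?thesis
    by cases (use 4 assms in \<open>auto simp: ports_def\<close>)
next
  case 5
  then show ?thesis using assms by (auto simp: ports_def)
qed

section \<open>The split graph: its two gluings, degrees and connectivity\<close>

definition slots :: "int \<Rightarrow> (int \<times> int) set" where
  "slots k = Sigma {0..<2 * k} (ports k)"

definition slot_edges :: "int \<Rightarrow> int set set" where
  "slot_edges k = (\<lambda>(z, d). {z, d}) ` slots k"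

text \<open>\<open>Inl x\<close> is the vertex \<open>x\<close> and \<open>Inr z\<close> is the visit \<open>z*\<close> split off from \<open>z\<close>.\<close>

definition split_edges :: "int \<Rightarrow> (int + int) set set" where
  "split_edges k = image Inl ` (undirected_edges (cycle_power k) - slot_edges k)
     \<union> (\<lambda>(z, d). {Inr z, Inl d}) ` slots k"

lemma finite_slots: "finite (slots k)"
  unfolding slots_def by (intro finite_SigmaI) (auto simp: ports_def)

lemma finite_edges: "finite (undirected_edges (cycle_power k))"
  by (rule finite_subset[of _ "Pow {0..<2 * k}"]) (auto simp: edges_cycle_power opp_adj_def)

lemma slot_edges_subset:
  assumes "k \<ge> 7"
  shows "slot_edges k \<subseteq> undirected_edges (cycle_power k)"
  using opp_adj_ports[OF assms] by (auto simp: slot_edges_def slots_def edge_cycle_power_iff)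

lemma inj_slots:
  assumes "k \<ge> 7"
  shows "inj_on (\<lambda>(z, d). {z, d}) (slots k)"
  using ports_asym[OF assms] by (auto simp: inj_on_def slots_def doubleton_eq_iff)

lemma shift_mem:
  assumes "k \<ge> 7" "odd k" "z \<in> {0..<2 * k}"
  shows "shift k z \<in> {0..<2 * k}"
  by (cases rule: shift_cases[OF assms]) (use assms(1) in auto)

lemma inj_shift_slots:
  assumes "k \<ge> 7" "odd k"
  shows "inj_on (\<lambda>(z, d). {shift k z, d}) (slots k)"
proof -
  have "z = w \<and> d = e"
    if *: "z \<in> {0..<2 * k}" "w \<in> {0..<2 * k}" "d \<in> ports k z" "e \<in> ports k w"
      "{shift k z, d} = {shift k w, e}" for z w d e
  proof -
    \<comment> \<open>Equal edges have equal or opposite orientations; injectivity of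
      \<open>shift\<close> settles the first case, \<open>shift_ports_asym\<close> the
      second.\<close>
    consider "shift k z = shift k w" "d = e" | "shift k z = e" "d = shift k w"
      using *(5) by (auto simp: doubleton_eq_iff)
    then show ?thesis
    proof cases
      case 1
      then show ?thesis using inj_onD[OF shift_inj[OF assms]] * by blast
    next
      case 2
      then show ?thesis using shift_ports_asym[OF assms *(1,2)] * by blast
    qed
  qed
  note key = this
  show ?thesis
  proof (rule inj_onI)
    fix s t
    assume "s \<in> slots k" "t \<in> slots k"
      "(case s of (z, d) \<Rightarrow> {shift k z, d}) = (case t of (z, d) \<Rightarrow> {shift k z, d})"
    then show "s = t"
      using key[of "fst s" "fst t" "snd s" "snd t"] by (auto simp: slots_def)
  qed
qed

text \<open>The inclusion comes from \<open>shift_ports\<close>; equality follows by counting, as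
  both sides are injective images of \<open>slots k\<close>.\<close>

lemma shift_slot_edges:
  assumes "k \<ge> 7" "odd k"
  shows "(\<lambda>(z, d). {shift k z, d}) ` slots k = slot_edges k"
proof (rule card_subset_eq)
  show "finite (slot_edges k)" using finite_slots by (simp add: slot_edges_def)
  show "card ((\<lambda>(z, d). {shift k z, d}) ` slots k) = card (slot_edges k)"
    unfolding slot_edges_def by (simp add: card_image inj_slots inj_shift_slots assms)
  show "(\<lambda>(z, d). {shift k z, d}) ` slots k \<subseteq> slot_edges k"
  proof clarify
    fix z d assume "(z, d) \<in> slots k"
    then have z: "z \<in> {0..<2 * k}" and d: "d \<in> ports k z" by (auto simp: slots_def)
    have "d \<in> {0..<2 * k}" using opp_adj_ports[OF assms(1) z d] by (auto simp: opp_adj_def)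
    then have "(shift k z, d) \<in> slots k \<or> (d, shift k z) \<in> slots k"
      using shift_ports[OF assms z d] shift_mem[OF assms z] by (auto simp: slots_def)
    then show "{shift k z, d} \<in> slot_edges k"
      unfolding slot_edges_def by (auto simp: insert_commute intro: rev_image_eqI)
  qed
qed

lemma bij_split_id:
  assumes "k \<ge> 7"
  shows "bij_betw (image (case_sum id id)) (split_edges k) (undirected_edges (cycle_power k))"
  unfolding split_edges_def
  using bij_betw_split[of id "slots k" "slot_edges k"] inj_slots[OF assms] slot_edges_subset[OF assms]
  by (simp add: slot_edges_def)

lemma bij_split_shift:
  assumes "k \<ge> 7" "odd k"
  shows "bij_betw (image (case_sum id (shift k))) (split_edges k) (undirected_edges (cycle_power k))"
  unfolding split_edges_def
  using bij_betw_split[OF inj_shift_slots shift_slot_edges slot_edges_subset] assms by simp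

lemma split_edges_vertex:
  assumes "k \<ge> 7" "e \<in> split_edges k" "w \<in> e"
  shows "case_sum id id w \<in> {0..<2 * k}"
proof -
  have "case_sum id id ` e \<in> undirected_edges (cycle_power k)"
    using bij_betwE[OF bij_split_id[OF assms(1)]] assms(2) by blast
  then obtain x y where xy: "case_sum id id ` e = {x, y}" "opp_adj k x y"
    unfolding edges_cycle_power by blast
  moreover have "case_sum id id w \<in> case_sum id id ` e" using assms(3) by (rule imageI)
  ultimately show ?thesis by (auto simp: opp_adj_def)
qed

lemma split_edges_card2:
  assumes "e \<in> split_edges k"
  shows "card e = 2"
  using assms
  by (auto simp: split_edges_def edges_cycle_power opp_adj_def card_insert_if)

lemma card_split_edges_Inr:
  assumes "k \<ge> 7"
  shows "card {e \<in> split_edges k. Inr z \<in> e} = (if z \<in> {0..<2 * k} then 2 else 0)"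
proof -
  have "{e \<in> split_edges k. Inr z \<in> e} = (if z \<in> {0..<2 * k} then (\<lambda>d. {Inr z, Inl d}) ` ports k z else {})"
    by (auto simp: split_edges_def slots_def)
  moreover have "inj_on (\<lambda>d. {Inr z, Inl d}) (ports k z)"
    by (auto simp: inj_on_def doubleton_eq_iff)
  ultimately show ?thesis using card_ports[OF assms] by (simp add: card_image)
qed

text \<open>Gluing adds the degrees of \<open>Inl x\<close> and \<open>Inr x\<close>. Their sum is
  \<open>2 * k - 4\<close> or 0 and \<open>Inr x\<close> has degree 2 or 0, hence
  \<open>Inl x\<close> has even degree.\<close>

lemma even_card_split_edges:
  assumes "k \<ge> 7"
  shows "even (card {e \<in> split_edges k. v \<in> e})"
proof (cases v)
  case (Inr z)
  then show ?thesis using card_split_edges_Inr[OF assms] by simp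
next
  case (Inl x)
  let ?\<pi> = "image (case_sum id id) :: (int + int) set \<Rightarrow> int set"
  let ?A = "{e \<in> split_edges k. Inl x \<in> e}" and ?B = "{e \<in> split_edges k. Inr x \<in> e}"
  have fin: "finite (split_edges k)"
    using finite_edges finite_slots by (simp add: split_edges_def)
  \<comment> \<open>An edge through both copies would make \<open>x\<close> its own port.\<close>
  have disj: "?A \<inter> ?B = {}"
  proof (intro equals0I)
    fix e assume e: "e \<in> ?A \<inter> ?B"
    then obtain z d where zd: "(z, d) \<in> slots k" "e = {Inr z, Inl d}"
      unfolding split_edges_def by auto
    then have "z = x" "d = x" using e by auto
    then have "opp_adj k x x" using opp_adj_ports[OF assms] zd(1) by (auto simp: slots_def)
    then show False by (simp add: opp_adj_def)
  qed
  have "{e \<in> undirected_edges (cycle_power k). x \<in> e} = ?\<pi> ` (?A \<union> ?B)"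
    unfolding bij_betw_imp_surj_on[OF bij_split_id[OF assms], symmetric]
    by (force split: sum.splits)
  moreover have "inj_on ?\<pi> (?A \<union> ?B)"
    using bij_betw_imp_inj_on[OF bij_split_id[OF assms]] by (rule inj_on_subset) auto
  ultimately have "card {e \<in> undirected_edges (cycle_power k). x \<in> e} = card ?A + card ?B"
    using fin disj by (simp add: card_image card_Un_disjoint)
  moreover have "even (card {e \<in> undirected_edges (cycle_power k). x \<in> e})"
  proof (cases "x \<in> {0..<2 * k}")
    case True
    then have "card {y. opp_adj k x y} = 2 * nat k - 4" using card_opp_adj[of k x] assms by (simp add: nat_mult_distrib)
    then show ?thesis unfolding card_edges_at by simp
  next
    case False
    then have empty: "{y. opp_adj k x y} = {}" by (auto simp: opp_adj_def)
    show ?thesis unfolding card_edges_at empty by simp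
  qed
  ultimately show ?thesis using card_split_edges_Inr[OF assms, of x] Inl by (auto split: if_splits)
qed

lemma split_edges_Inl:
  assumes "opp_adj k x y" "x \<notin> ports k y" "y \<notin> ports k x"
  shows "{Inl x, Inl y} \<in> split_edges k"
proof -
  have "{x, y} \<in> undirected_edges (cycle_power k) - slot_edges k"
    using assms by (auto simp: edge_cycle_power_iff slot_edges_def slots_def doubleton_eq_iff)
  then have "image Inl {x, y} \<in> split_edges k" unfolding split_edges_def by blast
  then show ?thesis by simp
qed

text \<open>Vertex 1 serves as a hub: all of \<open>{1..<k}\<close> hang on it directly, the other
  ordinary vertices by at most two steps, and each \<open>Inr z\<close> by one of its ports.\<close>

lemma connected_split_edges:
  assumes "k \<ge> 7" "e \<in> split_edges k" "v \<in> e"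
  shows "(Inr 0, v) \<in> {(x, y). {x, y} \<in> split_edges k}\<^sup>*"
proof -
  let ?R = "{(x, y). {x, y} \<in> split_edges k}"
  have sym: "(y, x) \<in> ?R\<^sup>*" if "(x, y) \<in> ?R\<^sup>*" for x y
    using that by (rule symD[OF sym_rtrancl, rotated]) (auto intro!: symI simp: insert_commute)
  have step: "(Inl x, Inl y) \<in> ?R" if "opp_adj k x y" "x \<notin> ports k y" "y \<notin> ports k x" for x y
    using split_edges_Inl[OF that] by simp
  have low: "(Inl 1, Inl x) \<in> ?R\<^sup>*" if "1 \<le> x" "x < k" for x
  proof (cases "x = 1")
    case False
    then show ?thesis using that assms(1)
      by (intro r_into_rtrancl step) (auto simp: opp_adj_def ports_def)
  qed simp
  have via: "(Inl 1, Inl y) \<in> ?R\<^sup>*"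
    if "(Inl 1, Inl x) \<in> ?R\<^sup>*" "opp_adj k x y" "x \<notin> ports k y" "y \<notin> ports k x" for x y
    using that(1) step[OF that(2-)] by (rule rtrancl_into_rtrancl)
  \<comment> \<open>This prepares the route to \<open>k + 6\<close>, which is a port of 1 to 4 and
    not adjacent to 5, 6 and 7.\<close>
  have k4: "(Inl 1, Inl (k + 4)) \<in> ?R\<^sup>*"
    using assms(1) by (intro via[OF low[of 1]]) (auto simp: opp_adj_def ports_def)
  \<comment> \<open>The intermediate vertex is 5 for 0, since 0 is a port of 1 to 4, and also for
    \<open>k\<close> and \<open>k + 1\<close>, which are not adjacent to 1. It is 4 for
    \<open>k + 2\<close>, which is a port of 5 to \<open>k - 1\<close>.\<close>
  have ord: "(Inl 1, Inl x) \<in> ?R\<^sup>*" if "x \<in> {0..<2 * k}" for x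
  proof -
    consider "1 \<le> x" "x < k" | "x = 0 \<or> x = k \<or> x = k + 1" | "x = k + 2"
      | "x = k + 3 \<or> x = k + 5 \<or> k + 7 \<le> x" | "x = k + 4" | "x = k + 6"
      using \<open>x \<in> {0..<2 * k}\<close> by fastforce
    then show ?thesis
    proof cases
      case 1
      then show ?thesis by (rule low)
    next
      case 2
      then show ?thesis using assms(1)
        by (intro via[OF low[of 5]]) (auto simp: opp_adj_def ports_def)
    next
      case 3
      then show ?thesis using assms(1)
        by (intro via[OF low[of 4]]) (auto simp: opp_adj_def ports_def)
    next
      case 4
      then show ?thesis using assms(1) that
        by (intro via[OF low[of 1]]) (auto simp: opp_adj_def ports_def)
    next
      case 5
      then show ?thesis using k4 by simp
    next
      case 6
      then show ?thesis using assms(1)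
        by (intro via[OF k4]) (auto simp: opp_adj_def ports_def)
    qed
  qed
  have slot: "(Inl d, Inr z) \<in> ?R" "d \<in> {0..<2 * k}" if "z \<in> {0..<2 * k}" "d \<in> ports k z" for z d
    using that opp_adj_ports[OF assms(1) that]
    by (auto simp: split_edges_def slots_def insert_commute opp_adj_def)
  have spec: "(Inl 1, Inr z) \<in> ?R\<^sup>*" if "z \<in> {0..<2 * k}" for z
  proof -
    obtain d where "d \<in> ports k z" using card_ports[OF assms(1), of z] by fastforce
    then show ?thesis using slot[OF that] ord by (meson rtrancl.rtrancl_into_rtrancl)
  qed
  have "(Inl 1, v) \<in> ?R\<^sup>*"
    using split_edges_vertex[OF assms] ord spec by (cases v) simp_all
  moreover have "(Inr 0, Inl 1) \<in> ?R\<^sup>*"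
    using sym[OF spec[of 0]] assms(1) by simp
  ultimately show ?thesis by (rule rtrancl_trans[rotated])
qed

section \<open>Avoiding circuits for odd \<open>k \<ge> 7\<close>, and the choice of
  \<open>k\<close> for given \<open>n\<close>\<close>

lemma doubly_eulerian_cycle_power:
  assumes "k \<ge> 7" "odd k"
  shows "doubly_eulerian (cycle_power k)"
proof -
  let ?f = "case_sum id id :: int + int \<Rightarrow> int" and ?g = "rot k k \<circ> case_sum id (shift k)"
  have k: "k \<in> {0..<2 * k}" using assms by simp
  have g: "bij_betw (image ?g) (split_edges k) (undirected_edges (cycle_power k))"
    using bij_betw_trans[OF bij_split_shift[OF assms] bij_betw_rot[OF k]]
    by (simp add: image_comp o_def)
  \<comment> \<open>At \<open>Inl x\<close> the two readings are antipodal, at \<open>Inr z\<close>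
    within 1 of antipodal. At \<open>Inr 0\<close> both are 0, whence its exclusion.\<close>
  have avoid: "?f w \<noteq> ?g w \<and> (?f w, ?g w) \<notin> parcs (cycle_power k)"
    if e: "e \<in> split_edges k" "w \<in> e" "w \<noteq> Inr 0" for e w
  proof (cases w)
    case (Inl x)
    then show ?thesis using assms by (auto simp: rot_def opp_adj_def)
  next
    case (Inr z)
    then have z: "z \<in> {0..<2 * k}" using split_edges_vertex[OF assms(1) e(1,2)] by simp
    show ?thesis
      by (cases rule: shift_cases[OF assms z]) (use Inr e(3) assms(1) in \<open>auto simp: rot_def opp_adj_def\<close>)
  qed
  have "\<exists>p q. eulerian_circuit (cycle_power k) 0 p \<and> eulerian_circuit (cycle_power k) 0 q \<and>
      avoiding (cycle_power k) p q"
  proof (rule avoiding_circuits_of_cover[where W = "split_edges k" and r = "Inr 0" and f = ?f and g = ?g])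
    show "finite (split_edges k)"
      using finite_edges finite_slots by (simp add: split_edges_def)
    show "card {e \<in> split_edges k. Inr 0 \<in> e} = 2"
      using card_split_edges_Inr assms(1) by simp
    \<comment> \<open>Since \<open>shift\<close> sends 0 to \<open>k\<close>, the rotation by
      \<open>k\<close> brings the root back to 0, so both circuits have the same base.\<close>
    show "?g (Inr 0) = 0"
      by (simp add: shift_def rot_def)
    show "\<forall>e\<in>split_edges k. \<forall>v\<in>e. (Inr 0, v) \<in> {(x, y). {x, y} \<in> split_edges k}\<^sup>*"
      using connected_split_edges[OF assms(1)] by blast
  qed (use assms g avoid pair_graph_cycle_power split_edges_card2 even_card_split_edges bij_split_id in auto)
  then show ?thesis
    using doubly_eulerian_cycle_powerI assms(1) by force
qed

theorem theorem4:
  fixes n :: nat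
  assumes "n mod 4 = 2" and "n \<ge> 10"
  shows "\<exists>G. circulant_graph n G \<and> regular_of_degree G (n - 4) \<and> doubly_eulerian G"
proof -
  \<comment> \<open>This is \<open>n / 2\<close>, in a form that shows that it is odd.\<close>
  define k where "k = 2 * int (n div 4) + 1"
  have "n = 4 * (n div 4) + 2" "n div 4 \<ge> 2"
    using assms by presburger+
  then have k: "n = nat (2 * k)" "k \<ge> 5" "odd k"
    by (simp_all add: k_def)
  then have "k = 5 \<or> k \<ge> 7" by presburger
  then have "doubly_eulerian (cycle_power k)"
    using doubly_eulerian_cycle_power_5 doubly_eulerian_cycle_power k(3) by blast
  moreover have "circulant_graph n (cycle_power k)" "regular_of_degree (cycle_power k) (n - 4)"
    using circulant_cycle_power[of k] regular_cycle_power[of k] k by simp_all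
  ultimately show ?thesis by blast
qed

end
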